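(* Let $n,k$ be positive integers with $k\ge 50$ and $n\ge 50k\ln k$ (natural logarithm). If $\mathcal F\subset\binom{[n]}{k}$ is an intersecting family, then $$|\mathcal D(\mathcal F)|\le \sum_{0\le \ell<k}\binom{n-1}{\ell}.$$
   Context: $[n]=\{1,\dots,n\}$ and $\binom{[n]}{k}$ is the family of all $k$-element subsets of $[n]$. A family $\mathcal F$ is intersecting if $F\cap F'\neq\varnothing$ for all $F,F'\in\mathcal F$. For a family $\mathcal F$, $\mathcal D(\mathcal F):=\{F\setminus F' : F,F'\in\mathcal F\}$ (the family of setwise differences). Note that the right-hand side equals $|\mathcal D(\mathcal S_x)|$ for a full star $\mathcal S_x=\{A\in\binom{[n]}{k}: x\in A\}$. *)

theory Defs
  imports Complex_Main
begin

definition intersecting :: "'a set set \<Rightarrow> bool" where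
  "intersecting F \<longleftrightarrow> (\<forall>A\<in>F. \<forall>B\<in>F. A \<inter> B \<noteq> {})"

definition diff_family :: "'a set set \<Rightarrow> 'a set set" where
  "diff_family F = {A - B | A B. A \<in> F \<and> B \<in> F}"

end

theory Submission
  imports Defs "HOL-Combinatorics.Permutations"
begin

text \<open>
  Levels below \<open>k - 1\<close> are negligible, so one may assume that almost every \<open>(k-1)\<close>-set \<open>D\<close> is a
  difference; then \<open>D \<union> {y(D)} \<in> \<F>\<close> for some \<open>y(D)\<close>. For disjoint \<open>D, D'\<close> the intersection
  property forces \<open>y(D) = y(D')\<close> up to rare exceptions, and comparing two arbitrary sets with a third
  one disjoint from both yields a label \<open>x\<close> shared by nine tenths of all \<open>(k-1)\<close>-sets.
  Let \<open>\<B>\<close> consist of the members of \<open>\<F>\<close> without \<open>x\<close> and \<open>\<U>\<close> of the \<open>(k-1)\<close>-sets without \<open>x\<close> that miss some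
  member of \<open>\<B>\<close>. Compared with the full star at \<open>x\<close>, the family \<open>\<D>(\<F>)\<close> loses \<open>\<U>\<close>, up to the shadow of
  \<open>\<B>\<close>, and gains only differences through \<open>x\<close>, which without \<open>x\<close> are smaller sets missing a member of
  \<open>\<B>\<close>: by local LYM these number at most \<open>|\<U>| / 100\<close>. Finally \<open>\<U>\<close> has density at most \<open>1/10\<close>, and a
  random \<open>B\<close> disjoint from \<open>t \<approx> n/k\<close> independent random \<open>(k-1)\<close>-sets lies in \<open>\<B>\<close> only if all \<open>t\<close> sets lie
  in \<open>\<U>\<close>. So the density of \<open>\<B>\<close> is at most the \<open>t\<close>-th power of that of \<open>\<U>\<close>, which makes the shadow of
  \<open>\<B>\<close> smaller than \<open>|\<U>| / 2\<close>; this is where \<open>n \<ge> 50 k ln k\<close> enters.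

  All averaging is over the permutations of the ground set, applied to a fixed configuration of sets.
\<close>

section \<open>Counting with random permutations of the ground set\<close>

abbreviation ksubsets :: "'a set \<Rightarrow> nat \<Rightarrow> 'a set set" where
  "ksubsets X r \<equiv> {S. S \<subseteq> X \<and> card S = r}"

lemma card_filter_eq_sum:
  "finite A \<Longrightarrow> card {x \<in> A. P x} = (\<Sum>x\<in>A. of_bool (P x))"
  by (simp add: sum.inter_filter [symmetric] of_bool_def)

lemma card_filter_split:
  assumes "finite A"
  shows "card {x \<in> A. P x} + card {x \<in> A. \<not> P x} = card A"
proof -
  have "card ({x \<in> A. P x} \<union> {x \<in> A. \<not> P x}) = card {x \<in> A. P x} + card {x \<in> A. \<not> P x}"
    using assms by (intro card_Un_disjoint) auto
  moreover have "{x \<in> A. P x} \<union> {x \<in> A. \<not> P x} = A"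
    by blast
  ultimately show ?thesis
    by simp
qed

text \<open>Double counting: each \<open>p\<close> only permutes \<open>Z\<close>, so the number of
  \<open>z\<close> with \<open>P (act p z)\<close> does not depend on \<open>p\<close>. A bound
  valid for every fixed \<open>z\<close> under a random \<open>p\<close> thus becomes a bound on the
  density of \<open>P\<close> in \<open>Z\<close>.\<close>

lemma sum_card_average:
  assumes "finite G" "finite Z" and bij: "\<And>p. p \<in> G \<Longrightarrow> bij_betw (act p) Z Z"
  shows "(\<Sum>z\<in>Z. card {p \<in> G. P (act p z)}) = card G * card {z \<in> Z. P z}"
proof -
  have "(\<Sum>z\<in>Z. card {p \<in> G. P (act p z)}) = (\<Sum>p\<in>G. \<Sum>z\<in>Z. of_bool (P (act p z)))"
    using assms(1) by (simp add: card_filter_eq_sum sum.swap [of _ Z])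
  also have "\<dots> = (\<Sum>p\<in>G. \<Sum>z\<in>Z. of_bool (P z))"
    by (intro sum.cong refl sum.reindex_bij_betw bij)
  finally show ?thesis
    using assms(2) by (simp add: card_filter_eq_sum)
qed

lemma permutes_image_exists:
  assumes "finite X" "S \<subseteq> X" "T \<subseteq> X" "card S = card T"
  obtains q where "q permutes X" "q ` S = T"
proof -
  have fin: "finite S" "finite T"
    using assms finite_subset by blast+
  obtain f where f: "bij_betw f S T"
    using fin assms(4) finite_same_card_bij by blast
  have "card (X - S) = card (X - T)"
    using assms fin by (simp add: card_Diff_subset)
  then obtain g where g: "bij_betw g (X - S) (X - T)"
    using assms(1) finite_same_card_bij by blast
  define q where "q = (\<lambda>x. if x \<in> S then f x else if x \<in> X then g x else x)"
  have "bij_betw q S T"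
    using f by (rule iffD1 [OF bij_betw_cong, rotated]) (simp add: q_def)
  moreover have "bij_betw q (X - S) (X - T)"
    using g by (rule iffD1 [OF bij_betw_cong, rotated]) (simp add: q_def)
  ultimately have "bij_betw q (S \<union> (X - S)) (T \<union> (X - T))"
    by (rule bij_betw_combine) blast
  then have "bij_betw q X X"
    using assms by (simp add: Un_absorb1)
  then have "q permutes X"
    using assms(2) by (intro bij_imp_permutes) (auto simp: q_def)
  moreover have "q ` S = T"
    using \<open>bij_betw q S T\<close> by (simp add: bij_betw_def)
  ultimately show ?thesis
    using that by blast
qed

text \<open>The permutations taking \<open>S\<close> to \<open>T\<close> form a coset of the
  stabilizer of \<open>S\<close>: compose with one fixed \<open>q\<close> taking \<open>S\<close> to
  \<open>T\<close>.\<close>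

lemma card_permutes_image_eq:
  assumes "finite X" "S \<subseteq> X" "T \<subseteq> X" "card S = card T"
  shows "card {p. p permutes X \<and> p ` S = T} = card {p. p permutes X \<and> p ` S = S}"
proof -
  obtain q where q: "q permutes X" "q ` S = T"
    using permutes_image_exists [OF assms] .
  have "bij_betw (\<lambda>p. q \<circ> p) {p. p permutes X \<and> p ` S = S} {p. p permutes X \<and> p ` S = T}"
  proof (rule bij_betw_byWitness [where f' = "\<lambda>p. inv q \<circ> p"])
    show "\<forall>p\<in>{p. p permutes X \<and> p ` S = S}. inv q \<circ> (q \<circ> p) = p"
      using q by (simp add: o_assoc permutes_inv_o)
    show "\<forall>p\<in>{p. p permutes X \<and> p ` S = T}. q \<circ> (inv q \<circ> p) = p"
      using q by (simp add: o_assoc permutes_inv_o)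
    show "(\<lambda>p. q \<circ> p) ` {p. p permutes X \<and> p ` S = S} \<subseteq> {p. p permutes X \<and> p ` S = T}"
      using q by (intro image_subsetI) (simp only: mem_Collect_eq image_comp [symmetric] permutes_compose simp_thms)
    have "inv q ` T = S"
      using q by (simp only: image_comp permutes_inv_o image_id flip: q(2)) simp
    then show "(\<lambda>p. inv q \<circ> p) ` {p. p permutes X \<and> p ` S = T} \<subseteq> {p. p permutes X \<and> p ` S = S}"
      using q by (intro image_subsetI)
        (simp only: mem_Collect_eq image_comp [symmetric] permutes_compose permutes_inv simp_thms)
  qed
  then show ?thesis
    by (rule bij_betw_same_card [symmetric])
qed

text \<open>Under a random permutation the image of a fixed set is uniform among the sets of its
  size. The probability is cross-multiplied so as to stay in the natural numbers.\<close>

lemma card_permutes_image_mem: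
  assumes "finite X" "S \<subseteq> X" "\<T> \<subseteq> ksubsets X (card S)"
  shows "card {p. p permutes X \<and> p ` S \<in> \<T>} * (card X choose card S) = fact (card X) * card \<T>"
proof -
  define c where "c = card {p. p permutes X \<and> p ` S = S}"
  have count: "card {p. p permutes X \<and> p ` S \<in> \<U>} = card \<U> * c" if "\<U> \<subseteq> ksubsets X (card S)" for \<U>
  proof -
    have fin: "finite \<U>"
      using that by (rule finite_subset) (use assms(1) in simp)
    have "{p. p permutes X \<and> p ` S \<in> \<U>} = (\<Union>T\<in>\<U>. {p. p permutes X \<and> p ` S = T})"
      by auto
    then have "card {p. p permutes X \<and> p ` S \<in> \<U>} = (\<Sum>T\<in>\<U>. card {p. p permutes X \<and> p ` S = T})"
      using fin finite_permutations [OF assms(1)] by (simp only:) (subst card_UN_disjoint, auto)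
    also have "\<dots> = (\<Sum>T\<in>\<U>. c)"
      unfolding c_def using that assms by (intro sum.cong refl card_permutes_image_eq) auto
    finally show ?thesis
      by simp
  qed
  have "p ` S \<in> ksubsets X (card S)" if "p permutes X" for p
    using image_mono [OF assms(2), of p] permutes_image [OF that]
    by (simp add: card_image permutes_inj_on [OF that])
  then have "{p. p permutes X \<and> p ` S \<in> ksubsets X (card S)} = {p. p permutes X}"
    by blast
  \<comment> \<open>Taking all sets of the given size as targets determines
    \<open>c\<close>.\<close>
  then have "fact (card X) = (card X choose card S) * c"
    using count [OF order_refl] assms(1) by (simp add: card_permutations n_subsets)
  then show ?thesis
    using count [OF assms(3)] by simp
qed

lemma card_permutes_hit_point:
  assumes "finite X" "u \<in> X - D"
  shows "card {p. p permutes X \<and> p u = f (p ` D)} * card (X - D) \<le> fact (card X)"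
proof -
  let ?C = "\<lambda>v. {p. p permutes X \<and> p v = f (p ` D)}"
  have fin: "finite (?C v)" for v
    using finite_permutations [OF assms(1)] by (rule rev_finite_subset) auto
  \<comment> \<open>Precomposing with the transposition of \<open>u\<close> and \<open>v\<close> does not affect \<open>p ` D\<close>.\<close>
  have eq: "card (?C v) = card (?C u)" if "v \<in> X - D" for v
  proof -
    let ?t = "transpose u v"
    have t: "?t permutes X" "?t ` D = D"
      using that assms(2) by (auto simp: permutes_swap_id transpose_image_eq)
    have 1: "p \<circ> ?t permutes X" "(p \<circ> ?t) ` D = p ` D" if "p permutes X" for p
      using t that by (simp_all only: image_comp [symmetric] permutes_compose)
    have "bij_betw (\<lambda>p. p \<circ> ?t) (?C v) (?C u)"
    proof (rule bij_betw_byWitness [where f' = "\<lambda>p. p \<circ> ?t"])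
      show "(\<lambda>p. p \<circ> ?t) ` ?C v \<subseteq> ?C u" "(\<lambda>p. p \<circ> ?t) ` ?C u \<subseteq> ?C v"
        using 1 by (intro image_subsetI, simp only: mem_Collect_eq, simp)+
    qed (simp_all add: comp_assoc)
    then show ?thesis
      by (rule bij_betw_same_card)
  qed
  have "(\<Sum>v\<in>X - D. card (?C v)) = card (\<Union>v\<in>X - D. ?C v)"
    by (rule card_UN_disjoint [symmetric])
      (use assms(1) fin in \<open>auto, metis injD permutes_inj\<close>)
  also have "\<dots> \<le> card {p. p permutes X}"
    using finite_permutations [OF assms(1)] by (intro card_mono) auto
  also have "\<dots> = fact (card X)"
    using assms(1) by (simp add: card_permutations)
  finally show ?thesis
    by (simp add: eq mult.commute)
qed

lemma card_permutes_hit_set: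
  assumes "finite X" "D' \<subseteq> X - D"
  shows "card {p. p permutes X \<and> f (p ` D) \<in> p ` D'} * card (X - D) \<le> card D' * fact (card X)"
proof -
  let ?C = "\<lambda>v. {p. p permutes X \<and> p v = f (p ` D)}"
  have "finite D'"
    using assms finite_subset by blast
  have "{p. p permutes X \<and> f (p ` D) \<in> p ` D'} = (\<Union>v\<in>D'. ?C v)"
    by force
  then have "card {p. p permutes X \<and> f (p ` D) \<in> p ` D'} \<le> (\<Sum>v\<in>D'. card (?C v))"
    by (simp only: card_UN_le [OF \<open>finite D'\<close>])
  then have "card {p. p permutes X \<and> f (p ` D) \<in> p ` D'} * card (X - D)
      \<le> (\<Sum>v\<in>D'. card (?C v) * card (X - D))"
    by (simp add: sum_distrib_right [symmetric])
  also have "\<dots> \<le> (\<Sum>v\<in>D'. fact (card X))"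
    using assms by (intro sum_mono card_permutes_hit_point) auto
  finally show ?thesis
    by simp
qed

lemma bij_betw_image_ksubsets:
  assumes "p permutes X"
  shows "bij_betw ((`) p) (ksubsets X r) (ksubsets X r)"
proof -
  have closed: "(`) q ` ksubsets X r \<subseteq> ksubsets X r" if "q permutes X" for q
  proof (rule image_subsetI)
    fix S assume "S \<in> ksubsets X r"
    then show "q ` S \<in> ksubsets X r"
      using image_mono [of S X q] permutes_image [OF that]
      by (simp add: card_image permutes_inj_on [OF that])
  qed
  show ?thesis
    by (rule bij_betw_byWitness [where f' = "(`) (inv p)"])
      (use assms in \<open>simp_all only: image_comp permutes_inv_o image_id id_apply ball_simps
         closed permutes_inv simp_thms\<close>)
qed

section \<open>A label shared by most sets\<close>

text \<open>Here \<delta> bounds the fraction of \<open>r\<close>-sets outside \<open>E\<close>, and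
  \<epsilon> the chance that the label of a random set falls into a random set disjoint from it. Two
  sets are compared through a third one disjoint from both, which makes a pair bad with probability
  at most 3\<delta> + 4\<epsilon>; averaging then yields one set whose label is shared by all but
  that fraction of the \<open>r\<close>-sets.\<close>

lemma exists_dominant_label:
  fixes y :: "'a set \<Rightarrow> 'a" and \<delta> \<epsilon> :: real
  assumes "finite X" and E: "E \<subseteq> ksubsets X r" and r: "0 < r" and n: "3 * r \<le> card X"
    and label: "\<And>D D'. D \<in> E \<Longrightarrow> D' \<in> E \<Longrightarrow> D \<inter> D' = {} \<Longrightarrow> y D = y D' \<or> y D \<in> D' \<or> y D' \<in> D"
    and dense: "(1 - \<delta>) * (card X choose r) \<le> card E"
    and small: "r \<le> \<epsilon> * (real (card X) - r)"
  shows "\<exists>z. (1 - 3 * \<delta> - 4 * \<epsilon>) * (card X choose r) \<le> card {D \<in> E. y D = z}"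
proof -
  define N where "N = card X choose r"
  define K where "K = ksubsets X r"
  define G where "G = {p. p permutes X}"
  define c where "c = 3 * \<delta> + 4 * \<epsilon>"
  define bad where "bad = (\<lambda>(D, D'). \<not> (D \<in> E \<and> D' \<in> E \<and> y D = y D'))"
  have N: "N > 0"
    unfolding N_def using n by simp
  have finK: "finite K" and cardK: "card K = N"
    using assms(1) by (simp_all add: K_def N_def n_subsets)
  have finG: "finite G" and cardG: "card G = fact (card X)"
    using assms(1) by (simp_all add: G_def finite_permutations card_permutations)
  have EK: "E \<subseteq> K"
    using E by (simp add: K_def)
  have miss: "card {p \<in> G. p ` D \<notin> E} \<le> \<delta> * card G" if "D \<in> K" for D
  proof -
    have D: "D \<subseteq> X" "card D = r"
      using that by (auto simp: K_def)
    have "{p \<in> G. p ` D \<notin> E} = {p. p permutes X \<and> p ` D \<in> K - E}"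
      using bij_betw_image_ksubsets [THEN bij_betwE] that unfolding G_def K_def by blast
    then have "card {p \<in> G. p ` D \<notin> E} * N = card G * card (K - E)"
      using card_permutes_image_mem [OF assms(1) D(1), of "K - E"] D(2) cardG
      by (simp add: N_def K_def)
    then have "real (card {p \<in> G. p ` D \<notin> E}) * N = card G * (real N - card E)"
      using EK finK by (simp add: card_Diff_subset finite_subset cardK card_mono of_nat_diff
          flip: of_nat_mult) (metis cardK card_mono of_nat_diff of_nat_mult)
    also have "\<dots> \<le> card G * (\<delta> * N)"
      using dense by (intro mult_left_mono) (simp_all add: N_def algebra_simps)
    finally show ?thesis
      using N by (simp add: mult_ac)
  qed
  have hit: "card {p \<in> G. y (p ` D) \<in> p ` D'} \<le> \<epsilon> * card G"
    if "D \<in> K" "D' \<in> K" "D \<inter> D' = {}" for D D'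
  proof -
    have D: "D' \<subseteq> X - D" "card D = r" "card D' = r" "D \<subseteq> X"
      using that by (auto simp: K_def)
    have "card (X - D) = card X - r"
      using D assms(1) by (simp add: card_Diff_subset finite_subset)
    then have rX: "real (card (X - D)) = real (card X) - r"
      using n by simp
    have "card {p \<in> G. y (p ` D) \<in> p ` D'} * card (X - D) \<le> r * card G"
      using card_permutes_hit_set [OF assms(1) D(1), of y] D(3) cardG by (simp add: G_def)
    then have "real (card {p \<in> G. y (p ` D) \<in> p ` D'}) * card (X - D) \<le> r * real (card G)"
      by (simp flip: of_nat_mult)
    also have "\<dots> \<le> (\<epsilon> * card (X - D)) * card G"
      using small rX by (intro mult_right_mono) simp_all
    finally have "real (card {p \<in> G. y (p ` D) \<in> p ` D'}) * card (X - D) \<le> (\<epsilon> * card G) * card (X - D)"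
      by (simp add: mult_ac)
    moreover have "card (X - D) > 0"
      using \<open>card (X - D) = card X - r\<close> n r by linarith
    ultimately show ?thesis
      by simp
  qed
  have bad_le: "card {p \<in> G. bad (map_prod ((`) p) ((`) p) z)} \<le> c * card G"
    if "z \<in> K \<times> K" for z
  proof -
    from that obtain D1 D2 where z: "z = (D1, D2)" and D: "D1 \<in> K" "D2 \<in> K"
      by blast
    have "card (D1 \<union> D2) \<le> 2 * r"
      using D card_Un_le [of D1 D2] by (simp add: K_def)
    then have "r \<le> card (X - (D1 \<union> D2))"
      using n diff_card_le_card_Diff [of "D1 \<union> D2" X] D finite_subset [OF _ assms(1)]
      by (auto simp: K_def)
    then obtain D3 where D3: "D3 \<subseteq> X - (D1 \<union> D2)" "card D3 = r"
      by (meson obtain_subset_with_card_n)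
    then have K3: "D3 \<in> K" "D1 \<inter> D3 = {}" "D2 \<inter> D3 = {}" "D3 \<inter> D1 = {}" "D3 \<inter> D2 = {}"
      by (auto simp: K_def)
    let ?M = "\<lambda>D. {p \<in> G. p ` D \<notin> E}"
    let ?H = "\<lambda>D D'. {p \<in> G. y (p ` D) \<in> p ` D'}"
    \<comment> \<open>Outside these seven events the images of \<open>D1\<close> and
      \<open>D2\<close> both carry the label of the image of \<open>D3\<close>. The three
      \<open>?M\<close> cost \<delta> each, the four \<open>?H\<close> cost \<epsilon> each.\<close>
    let ?U = "[?M D1, ?M D2, ?M D3, ?H D1 D3, ?H D3 D1, ?H D2 D3, ?H D3 D2]"
    have "{p \<in> G. bad (map_prod ((`) p) ((`) p) z)} \<subseteq> \<Union>(set ?U)"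
    proof
      fix p assume p: "p \<in> {p \<in> G. bad (map_prod ((`) p) ((`) p) z)}"
      show "p \<in> \<Union>(set ?U)"
      proof (rule ccontr)
        assume "p \<notin> \<Union>(set ?U)"
        then have in_E: "p ` D1 \<in> E" "p ` D2 \<in> E" "p ` D3 \<in> E"
          and not_hit: "y (p ` D1) \<notin> p ` D3" "y (p ` D3) \<notin> p ` D1"
            "y (p ` D2) \<notin> p ` D3" "y (p ` D3) \<notin> p ` D2"
          using p by simp_all
        have "inj p"
          using p by (auto simp: G_def intro: permutes_inj)
        then have "p ` D1 \<inter> p ` D3 = {}" "p ` D2 \<inter> p ` D3 = {}"
          using K3 by (simp_all add: image_Int [symmetric])
        then have "y (p ` D1) = y (p ` D3)" "y (p ` D2) = y (p ` D3)"
          using label in_E not_hit by metis+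
        then show False
          using p in_E by (simp add: bad_def z)
      qed
    qed
    then have "card {p \<in> G. bad (map_prod ((`) p) ((`) p) z)} \<le> card (\<Union>(set ?U))"
      by (rule card_mono [rotated]) (use finG in auto)
    also have "\<dots> \<le> sum_list (map card ?U)"
      by (simp only: list.set list.map sum_list.Cons sum_list.Nil Union_insert Union_empty)
        (intro card_Un_le [THEN order_trans] add_mono order_refl; simp)
    finally have "real (card {p \<in> G. bad (map_prod ((`) p) ((`) p) z)}) \<le> sum_list (map card ?U)"
      by (simp only: of_nat_le_iff)
    also have "\<dots> \<le> c * card G"
      using miss [OF D(1)] miss [OF D(2)] miss [OF K3(1)] hit [OF D(1) K3(1,2)] hit [OF D(2) K3(1,3)]
        hit [OF K3(1) D(1) K3(4)] hit [OF K3(1) D(2) K3(5)]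
      by (simp add: c_def algebra_simps)
    finally show ?thesis .
  qed
  \<comment> \<open>The bound for each fixed pair is averaged over all pairs, including overlapping
    and equal ones.\<close>
  have "real (card G * card {z \<in> K \<times> K. bad z})
      = (\<Sum>z\<in>K \<times> K. card {p \<in> G. bad (map_prod ((`) p) ((`) p) z)})"
    by (subst sum_card_average [where act = "\<lambda>p. map_prod ((`) p) ((`) p)"])
      (use finG finK bij_betw_image_ksubsets in \<open>auto simp: G_def K_def intro: bij_betw_map_prod\<close>)
  also have "\<dots> \<le> (\<Sum>z\<in>K \<times> K. c * card G)"
    unfolding of_nat_sum using bad_le by (rule sum_mono)
  also have "\<dots> = card G * (c * N * N)"
    by (simp add: card_cartesian_product cardK)
  finally have few_bad: "card {z \<in> K \<times> K. bad z} \<le> c * N * N"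
    using cardG by simp
  show ?thesis
  proof (rule ccontr)
    assume "\<not> ?thesis"
    then have less: "card {D \<in> E. y D = z} < (1 - c) * N" for z
      by (simp add: c_def N_def not_le algebra_simps)
    \<comment> \<open>All good partners of \<open>D\<close> carry the label of \<open>D\<close>, so
      they lie in a single label class.\<close>
    have row: "card {D' \<in> K. \<not> bad (D, D')} < (1 - c) * N" for D
    proof -
      have "card {D' \<in> K. \<not> bad (D, D')} \<le> card {D' \<in> E. y D' = y D}"
        using finite_subset [OF EK finK] by (intro card_mono) (auto simp: bad_def)
      then show ?thesis
        using less [of "y D"] by linarith
    qed
    have "K \<noteq> {}"
      using cardK N by auto
    have "{z \<in> K \<times> K. \<not> bad z} = (SIGMA D : K. {D' \<in> K. \<not> bad (D, D')})"
      by auto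
    then have "real (card {z \<in> K \<times> K. \<not> bad z}) = (\<Sum>D\<in>K. card {D' \<in> K. \<not> bad (D, D')})"
      using finK by simp
    also have "\<dots> < (\<Sum>D\<in>K. (1 - c) * N)"
      unfolding of_nat_sum using row finK \<open>K \<noteq> {}\<close> by (intro sum_strict_mono) auto
    also have "\<dots> = N * N - c * N * N"
      by (simp add: cardK algebra_simps)
    finally have "real (card {z \<in> K \<times> K. \<not> bad z}) + card {z \<in> K \<times> K. bad z} < N * N"
      using few_bad by linarith
    moreover have "card {z \<in> K \<times> K. bad z} + card {z \<in> K \<times> K. \<not> bad z} = N * N"
      using card_filter_split [of "K \<times> K" bad] finK by (simp add: card_cartesian_product cardK)
    ultimately show False
      by (simp flip: of_nat_add of_nat_mult)
  qed
qed

section \<open>A power bound for the avoided family\<close>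

text \<open>Every \<open>t\<close>-tuple of \<open>r\<close>-sets leaves room for a
  \<open>k\<close>-set \<open>B\<close> disjoint from all of them. After a random permutation,
  \<open>B\<close> can land in \<B> only if the whole tuple lands in \<open>U\<close>. The tuples
  range over the full power of the family of \<open>r\<close>-sets, so on average the latter has
  probability exactly the \<open>t\<close>-th power of the density of \<open>U\<close>.\<close>

lemma card_avoided_family_power:
  assumes "finite X" "t * r + k \<le> card X" and \<B>: "\<B> \<subseteq> ksubsets X k" and U: "U \<subseteq> ksubsets X r"
    and avoid: "\<And>S B. S \<in> ksubsets X r \<Longrightarrow> B \<in> \<B> \<Longrightarrow> S \<inter> B = {} \<Longrightarrow> S \<in> U"
  shows "card \<B> * (card X choose r) ^ t \<le> (card X choose k) * card U ^ t"
proof -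
  define K where "K = ksubsets X r"
  define Z where "Z = {xs. set xs \<subseteq> K \<and> length xs = t}"
  define G where "G = {p. p permutes X}"
  have finK: "finite K" and cardK: "card K = card X choose r"
    using assms(1) by (simp_all add: K_def n_subsets)
  have finZ: "finite Z" and cardZ: "card Z = (card X choose r) ^ t"
    using finK by (simp_all add: Z_def finite_lists_length_eq card_lists_length_eq cardK)
  have finG: "finite G" and cardG: "card G = fact (card X)"
    using assms(1) by (simp_all add: G_def finite_permutations card_permutations)
  have bound: "card G * card \<B> \<le> card {p \<in> G. set (map ((`) p) xs) \<subseteq> U} * (card X choose k)"
    if "xs \<in> Z" for xs
  proof -
    have "card (\<Union>(set xs)) \<le> (\<Sum>S\<in>set xs. card S)"
      by (rule card_Union_le_sum_card)
    also have "\<dots> = card (set xs) * r"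
      using that by (simp add: Z_def K_def subset_iff)
    also have "\<dots> \<le> t * r"
      using that card_length [of xs] by (simp add: Z_def)
    finally have "card (\<Union>(set xs)) \<le> t * r" .
    moreover have "finite (\<Union>(set xs))"
      using that by (intro finite_subset [OF _ assms(1)]) (auto simp: Z_def K_def)
    ultimately have "k \<le> card (X - \<Union>(set xs))"
      using diff_card_le_card_Diff [of "\<Union>(set xs)" X] assms(2) by linarith
    then obtain B where B: "B \<subseteq> X - \<Union>(set xs)" "card B = k"
      by (meson obtain_subset_with_card_n)
    have "p \<in> {p \<in> G. set (map ((`) p) xs) \<subseteq> U}" if p: "p permutes X" "p ` B \<in> \<B>" for p
    proof -
      have "p ` S \<in> U" if "S \<in> set xs" for S
      proof (rule avoid)
        show "p ` S \<in> ksubsets X r"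
          using that \<open>xs \<in> Z\<close> bij_betw_image_ksubsets [OF p(1), THEN bij_betwE]
          unfolding Z_def K_def by blast
        have "S \<inter> B = {}"
          using that B by blast
        then show "p ` S \<inter> p ` B = {}"
          using permutes_inj [OF p(1)] by (simp add: image_Int [symmetric])
      qed (fact p(2))
      then show ?thesis
        using p by (auto simp: G_def)
    qed
    then have "card {p. p permutes X \<and> p ` B \<in> \<B>} \<le> card {p \<in> G. set (map ((`) p) xs) \<subseteq> U}"
      using finG by (intro card_mono) auto
    then have "card {p. p permutes X \<and> p ` B \<in> \<B>} * (card X choose k)
        \<le> card {p \<in> G. set (map ((`) p) xs) \<subseteq> U} * (card X choose k)"
      by (rule mult_right_mono) simp
    moreover have "B \<subseteq> X"
      using B(1) by blast
    then have "card {p. p permutes X \<and> p ` B \<in> \<B>} * (card X choose k) = card G * card \<B>"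
      using card_permutes_image_mem [of X B \<B>] assms(1) B(2) \<B> cardG by simp
    ultimately show ?thesis
      by linarith
  qed
  have bij: "bij_betw (map ((`) p)) Z Z" if "p \<in> G" for p
  proof -
    have "bij_betw ((`) p) K K" "p permutes X"
      using that by (auto simp: G_def K_def bij_betw_image_ksubsets)
    then have "inj_on (map ((`) p)) Z"
      unfolding Z_def
      by (intro inj_onI) (metis (mono_tags, lifting) bij_betw_def inj_on_map_eq_map inj_on_subset
          mem_Collect_eq le_sup_iff)
    moreover have "map ((`) p) ` Z \<subseteq> Z"
      using bij_betwE [OF \<open>bij_betw ((`) p) K K\<close>] by (auto simp: Z_def subset_iff)
    ultimately show ?thesis
      using finZ by (simp add: bij_betw_def endo_inj_surj)
  qed
  have "card Z * (card G * card \<B>)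
      \<le> (\<Sum>xs\<in>Z. card {p \<in> G. set (map ((`) p) xs) \<subseteq> U} * (card X choose k))"
    using sum_mono [of Z, OF bound] by simp
  also have "\<dots> = card G * card {xs \<in> Z. set xs \<subseteq> U} * (card X choose k)"
    using sum_card_average [of G Z "\<lambda>p. map ((`) p)" "\<lambda>xs. set xs \<subseteq> U", OF finG finZ bij]
    by (simp add: sum_distrib_right [symmetric])
  also have "{xs \<in> Z. set xs \<subseteq> U} = {xs. set xs \<subseteq> U \<and> length xs = t}"
    using U by (auto simp: Z_def K_def)
  also have "card \<dots> = card U ^ t"
    using finite_subset [OF U] assms(1) by (simp add: card_lists_length_eq)
  finally show ?thesis
    using cardG by (simp add: cardZ mult_ac)
qed

section \<open>Local LYM for sets missing a member of a family\<close>

text \<open>At level \<open>k - 1\<close> this is the family \<U> of the overview; the lower levels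
  receive the differences through \<open>x\<close> once \<open>x\<close> is deleted.\<close>

definition avoiding :: "'a set \<Rightarrow> 'a set set \<Rightarrow> nat \<Rightarrow> 'a set set" where
  "avoiding Y \<B> l = {S \<in> ksubsets Y l. \<exists>B\<in>\<B>. S \<inter> B = {}}"

lemma finite_avoiding: "finite Y \<Longrightarrow> finite (avoiding Y \<B> l)"
  by (simp add: avoiding_def)

text \<open>Double count inclusions between consecutive levels: a set missing \<open>B\<close> still
  misses it after adding any point outside both, while an upper set has only \<open>Suc l\<close>
  subsets of size \<open>l\<close>.\<close>

lemma card_avoiding_Suc:
  assumes "finite Y" "\<B> \<subseteq> ksubsets Y k"
  shows "card (avoiding Y \<B> l) * (card Y - k - l) \<le> Suc l * card (avoiding Y \<B> (Suc l))"
proof -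
  let ?U = "avoiding Y \<B>"
  have fin: "finite (?U j)" for j
    using assms(1) by (rule finite_avoiding)
  have up: "card Y - k - l \<le> card {S' \<in> ?U (Suc l). S \<subseteq> S'}" if "S \<in> ?U l" for S
  proof -
    from that obtain B where S: "S \<subseteq> Y" "card S = l" and B: "B \<in> \<B>" "S \<inter> B = {}"
      by (auto simp: avoiding_def)
    have "B \<subseteq> Y" "card B = k"
      using B(1) assms(2) by auto
    have finS: "finite S" "finite B"
      using S \<open>B \<subseteq> Y\<close> assms(1) finite_subset by blast+
    have "card Y - k - l = card (Y - B - S)"
      using S B \<open>B \<subseteq> Y\<close> \<open>card B = k\<close> finS assms(1)
      by (subst card_Diff_subset; (subst card_Diff_subset)?) auto
    also have "\<dots> = card ((\<lambda>v. insert v S) ` (Y - B - S))"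
      by (rule card_image [symmetric]) (auto intro: inj_onI)
    also have "\<dots> \<le> card {S' \<in> ?U (Suc l). S \<subseteq> S'}"
      using S B finS assms(1) by (intro card_mono) (auto simp: avoiding_def)
    finally show ?thesis .
  qed
  have down: "card {S \<in> ?U l. S \<subseteq> S'} \<le> Suc l" if "S' \<in> ?U (Suc l)" for S'
  proof -
    have S': "finite S'" "card S' = Suc l"
      using that assms(1) by (auto simp: avoiding_def intro: finite_subset)
    have "card {S \<in> ?U l. S \<subseteq> S'} \<le> card (ksubsets S' l)"
      using S' by (intro card_mono) (auto simp: avoiding_def)
    also have "\<dots> = Suc l"
      using S' by (simp add: n_subsets)
    finally show ?thesis .
  qed
  have "card (?U l) * (card Y - k - l) \<le> (\<Sum>S\<in>?U l. card {S' \<in> ?U (Suc l). S \<subseteq> S'})"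
    using sum_mono [of "?U l", OF up] by simp
  also have "\<dots> = (\<Sum>S'\<in>?U (Suc l). card {S \<in> ?U l. S \<subseteq> S'})"
    by (simp only: card_filter_eq_sum [OF fin] sum.swap [of _ "?U l"])
  also have "\<dots> \<le> (\<Sum>S'\<in>?U (Suc l). Suc l)"
    by (rule sum_mono [OF down])
  finally show ?thesis
    by (simp add: mult.commute)
qed

text \<open>The factor 101 is 100 for the new summand plus 1 for the sum already bounded.\<close>

lemma sum_le_of_fast_growth:
  fixes f :: "nat \<Rightarrow> nat"
  assumes "\<And>l. l < K \<Longrightarrow> 101 * f l \<le> f (Suc l)"
  shows "100 * (\<Sum>l<K. f l) \<le> f K"
  using assms by (induction K) (simp, fastforce)

lemma sum_card_avoiding_le:
  assumes "finite Y" "\<B> \<subseteq> ksubsets Y k" "k + 102 * r \<le> card Y"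
  shows "100 * (\<Sum>l<r. card (avoiding Y \<B> l)) \<le> card (avoiding Y \<B> r)"
proof (rule sum_le_of_fast_growth)
  fix l assume "l < r"
  then have "101 * Suc l \<le> card Y - k - l"
    using assms(3) by simp
  then have "card (avoiding Y \<B> l) * (101 * Suc l) \<le> card (avoiding Y \<B> l) * (card Y - k - l)"
    by (rule mult_left_mono) simp
  also have "\<dots> \<le> Suc l * card (avoiding Y \<B> (Suc l))"
    using assms(1,2) by (rule card_avoiding_Suc)
  finally have "Suc l * (101 * card (avoiding Y \<B> l)) \<le> Suc l * card (avoiding Y \<B> (Suc l))"
    by (simp only: mult_ac)
  then show "101 * card (avoiding Y \<B> l) \<le> card (avoiding Y \<B> (Suc l))"
    by (simp only: mult_le_cancel1 zero_less_Suc simp_thms)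
qed

lemma sum_choose_le:
  assumes "102 * r \<le> n"
  shows "100 * (\<Sum>l<r. n choose l) \<le> n choose r"
proof -
  \<comment> \<open>Every set misses the empty set, so full levels are a special case.\<close>
  have "avoiding {..<n} {{}} l = ksubsets {..<n} l" for l
    by (simp add: avoiding_def)
  then have "card (avoiding {..<n} {{}} l) = n choose l" for l
    by (simp add: n_subsets)
  then show ?thesis
    using sum_card_avoiding_le [of "{..<n}" "{{}}" 0 r] assms by simp
qed

section \<open>Comparison with the full star\<close>

lemma diff_familyE:
  assumes "D \<in> diff_family \<F>" "\<F> \<subseteq> ksubsets X k" "intersecting \<F>" "finite X"
  obtains A B where "A \<in> \<F>" "B \<in> \<F>" "D = A - B" "A \<subseteq> X" "card A = k" "finite A"
    "card D < k" "card D + card (A \<inter> B) = k"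
proof -
  obtain A B where AB: "A \<in> \<F>" "B \<in> \<F>" "D = A - B"
    using assms(1) by (auto simp: diff_family_def)
  then have A: "A \<subseteq> X" "card A = k" "finite A"
    using assms(2,4) finite_subset by blast+
  have "card (A \<inter> B) > 0"
    using AB A(3) assms(3) by (simp add: intersecting_def card_gt_0_iff)
  moreover have "card D + card (A \<inter> B) = k"
    using A AB(3) card_Diff_subset_Int [of A B] card_mono [of A "A \<inter> B"] by simp
  ultimately show ?thesis
    using that AB A by auto
qed

text \<open>A difference \<open>A - B\<close> through \<open>x\<close> has \<open>B\<close> in \<B>,
  and without \<open>x\<close> it is a set of size below \<open>k - 1\<close> missing
  \<open>B\<close>. A difference without \<open>x\<close> of size \<open>k - 1\<close> that misses a
  member of \<B> must lie in the shadow of \<B>. The loss stands on the left to avoid truncated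
  subtraction.\<close>

lemma card_diff_family_le:
  assumes "finite X" and \<F>: "\<F> \<subseteq> ksubsets X k" and int: "intersecting \<F>" and "x \<in> X"
  defines "\<B> \<equiv> {A \<in> \<F>. x \<notin> A}" and "Y \<equiv> X - {x}"
  shows "card (diff_family \<F>) + card (avoiding Y \<B> (k - 1))
    \<le> (\<Sum>l<k. (card X - 1) choose l) + (\<Sum>l<k - 1. card (avoiding Y \<B> l)) + k * card \<B>"
proof (cases "k = 0")
  case True
  \<comment> \<open>The empty set does not meet itself, so no member of size 0 is possible.\<close>
  have "A = {}" if "A \<in> \<F>" for A
    using that True \<F> finite_subset [OF _ assms(1)] by auto
  then have "\<F> = {}"
    using int unfolding intersecting_def by blast
  then show ?thesis
    by (simp add: diff_family_def avoiding_def \<B>_def)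
next
  case False
  let ?D = "diff_family \<F>"
  let ?U = "avoiding Y \<B>"
  have Y: "finite Y" "card Y = card X - 1"
    using assms(1,4) by (simp_all add: Y_def)
  have fin\<B>: "finite \<B>"
    unfolding \<B>_def using \<F> assms(1) by (simp add: finite_subset)
  have "?D \<subseteq> Pow X"
    using \<F> by (auto simp: diff_family_def)
  then have finD: "finite ?D"
    using assms(1) by (simp add: finite_subset)
  have finB: "finite B" "card B = k" if "B \<in> \<B>" for B
    using that \<F> assms(1) by (auto simp: \<B>_def intro: finite_subset)

  have "(\<lambda>D. D - {x}) ` {D \<in> ?D. x \<in> D} \<subseteq> (\<Union>l<k - 1. ?U l)"
  proof (rule image_subsetI)
    fix D assume D: "D \<in> {D \<in> ?D. x \<in> D}"
    then obtain A B where AB: "A \<in> \<F>" "B \<in> \<F>" "D = A - B" "A \<subseteq> X" "finite A" "card D < k"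
      using diff_familyE [OF _ \<F> int assms(1)] by blast
    have "card (D - {x}) < k - 1"
      using D AB card_gt_0_iff [of D] by (auto simp: card_Diff_singleton)
    moreover have "B \<in> \<B>" "D - {x} \<subseteq> Y" "(D - {x}) \<inter> B = {}"
      using D AB by (auto simp: \<B>_def Y_def)
    ultimately show "D - {x} \<in> (\<Union>l<k - 1. ?U l)"
      by (auto simp: avoiding_def)
  qed
  moreover have "inj_on (\<lambda>D. D - {x}) {D \<in> ?D. x \<in> D}"
    by (rule inj_onI) blast
  ultimately have "card {D \<in> ?D. x \<in> D} \<le> card (\<Union>l<k - 1. ?U l)"
    using Y(1) by (intro card_inj_on_le) (auto simp: finite_avoiding)
  then have with_x: "card {D \<in> ?D. x \<in> D} \<le> (\<Sum>l<k - 1. card (?U l))"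
    using card_UN_le [of "{..<k - 1}" ?U] by simp

  define S where "S = (\<Union>B\<in>\<B>. (\<lambda>v. B - {v}) ` B)" \<comment> \<open>the shadow of \<open>\<B>\<close>\<close>
  have finS: "finite S"
    using fin\<B> finB by (auto simp: S_def)
  have "card S \<le> (\<Sum>B\<in>\<B>. card ((\<lambda>v. B - {v}) ` B))"
    unfolding S_def using fin\<B> by (rule card_UN_le)
  also have "\<dots> \<le> (\<Sum>B\<in>\<B>. k)"
    by (rule sum_mono) (metis finB card_image_le)
  finally have cardS: "card S \<le> k * card \<B>"
    by (simp add: mult.commute)

  have "{D \<in> ?D. x \<notin> D} \<subseteq> (\<Union>l<k - 1. ksubsets Y l) \<union> (ksubsets Y (k - 1) - (?U (k - 1) - S))"
  proof
    fix D assume D: "D \<in> {D \<in> ?D. x \<notin> D}"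
    then obtain A B where AB: "A \<in> \<F>" "B \<in> \<F>" "D = A - B" "A \<subseteq> X" "card A = k" "finite A" "card D < k"
        "card D + card (A \<inter> B) = k"
      using diff_familyE [OF _ \<F> int assms(1)] by blast
    have "D \<subseteq> Y"
      using D AB by (auto simp: Y_def)
    moreover have "D \<in> S" if "card D = k - 1" "D \<in> ?U (k - 1)"
    proof -
      have "card (A \<inter> B) = 1"
        using that(1) AB False by linarith
      then obtain v where v: "A \<inter> B = {v}"
        by (rule card_1_singletonE)
      then have "D = A - {v}" "v \<in> A"
        using AB(3) by auto
      \<comment> \<open>Otherwise \<open>A\<close> is \<open>D\<close> together with
        \<open>x\<close>, and a member of \<B> missing \<open>D\<close> would miss \<open>A\<close>
        too.\<close>
      moreover have "x \<notin> A"
      proof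
        assume "x \<in> A"
        then have "A = insert x D"
          using D \<open>D = A - {v}\<close> by auto
        moreover from that(2) obtain C where "C \<in> \<F>" "x \<notin> C" "D \<inter> C = {}"
          by (auto simp: avoiding_def \<B>_def)
        ultimately have "A \<inter> C = {}"
          by blast
        then show False
          using int AB(1) \<open>C \<in> \<F>\<close> unfolding intersecting_def by blast
      qed
      ultimately show ?thesis
        using AB(1) by (auto simp: S_def \<B>_def)
    qed
    moreover have "card D < k - 1 \<or> card D = k - 1"
      using \<open>card D < k\<close> by linarith
    ultimately show "D \<in> (\<Union>l<k - 1. ksubsets Y l) \<union> (ksubsets Y (k - 1) - (?U (k - 1) - S))"
      by blast
  qed
  then have "card {D \<in> ?D. x \<notin> D}
      \<le> card ((\<Union>l<k - 1. ksubsets Y l) \<union> (ksubsets Y (k - 1) - (?U (k - 1) - S)))"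
    using Y(1) by (intro card_mono) auto
  also have "\<dots> \<le> card (\<Union>l<k - 1. ksubsets Y l) + card (ksubsets Y (k - 1) - (?U (k - 1) - S))"
    by (rule card_Un_le)
  finally have "card {D \<in> ?D. x \<notin> D}
      \<le> card (\<Union>l<k - 1. ksubsets Y l) + card (ksubsets Y (k - 1) - (?U (k - 1) - S))" .
  moreover have "card (\<Union>l<k - 1. ksubsets Y l) \<le> (\<Sum>l<k - 1. (card X - 1) choose l)"
    using card_UN_le [of "{..<k - 1}" "ksubsets Y"] Y by (simp add: n_subsets)
  moreover have "card (ksubsets Y (k - 1) - (?U (k - 1) - S)) + card (?U (k - 1) - S) = (card X - 1) choose (k - 1)"
  proof -
    have sub: "?U (k - 1) - S \<subseteq> ksubsets Y (k - 1)"
      by (auto simp: avoiding_def)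
    have "finite (ksubsets Y (k - 1))"
      using Y(1) by simp
    then show ?thesis
      using card_Diff_subset [OF finite_subset [OF sub] sub] card_mono [OF _ sub] Y
      by (simp add: n_subsets)
  qed
  moreover have "card (?U (k - 1)) \<le> card (?U (k - 1) - S) + card S"
    using diff_card_le_card_Diff [OF finS, of "?U (k - 1)"] by linarith
  moreover have "card ?D = card {D \<in> ?D. x \<in> D} + card {D \<in> ?D. x \<notin> D}"
    using card_filter_split [OF finD] by simp
  moreover have "(\<Sum>l<k. (card X - 1) choose l)
      = (\<Sum>l<k - 1. (card X - 1) choose l) + ((card X - 1) choose (k - 1))"
    using False by (cases k) simp_all
  ultimately show ?thesis
    using with_x cardS by linarith
qed

section \<open>Numerical bounds for the shadow\<close>

text \<open>\<open>Suc r * card \<B>\<close> bounds the shadow of \<B>. In the power bound with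
  exponent \<open>Suc s\<close>, one factor supplies \<open>card U\<close>; the other
  \<open>s\<close> factors are at most 1/10 each and together outweigh the \<open>2 * card X\<close>
  left by binomial absorption.\<close>

lemma mult_card_avoided_family_le:
  assumes "finite X" and \<B>: "\<B> \<subseteq> ksubsets X (Suc r)" and U: "U \<subseteq> ksubsets X r"
    and avoid: "\<And>S B. S \<in> ksubsets X r \<Longrightarrow> B \<in> \<B> \<Longrightarrow> S \<inter> B = {} \<Longrightarrow> S \<in> U"
    and size: "Suc s * r + Suc r \<le> card X" "2 * card X \<le> 10 ^ s"
    and small: "10 * card U \<le> card X choose r"
  shows "2 * (Suc r * card \<B>) \<le> card U"
proof -
  define C where "C = card X choose r"
  have "C > 0"
    unfolding C_def using size(1) by simp
  have "Suc r * (card X choose Suc r) = (card X - r) * C"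
    unfolding C_def by (simp only: times_binomial_minus1_eq binomial_absorb_comp zero_less_Suc diff_Suc_1)
  then have absorb: "Suc r * (card X choose Suc r) \<le> card X * C"
    by simp
  have "card \<B> * C ^ Suc s \<le> (card X choose Suc r) * card U ^ Suc s"
    unfolding C_def using assms(1) size(1) \<B> U avoid by (rule card_avoided_family_power)
  then have "Suc r * (card \<B> * C ^ Suc s) \<le> Suc r * ((card X choose Suc r) * card U ^ Suc s)"
    by (rule mult_left_mono) simp
  also have "\<dots> = (Suc r * (card X choose Suc r)) * card U ^ Suc s"
    by (simp only: mult.assoc)
  also have "\<dots> \<le> (card X * C) * card U ^ Suc s"
    using absorb by (rule mult_right_mono) simp
  finally have "C * ((Suc r * card \<B>) * C ^ s) \<le> C * (card X * card U * card U ^ s)"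
    by (simp only: power_Suc mult_ac)
  then have "(Suc r * card \<B>) * C ^ s \<le> card X * card U * card U ^ s"
    using \<open>C > 0\<close> by (simp only: mult_le_cancel1 simp_thms)
  then have "(2 * 10 ^ s) * ((Suc r * card \<B>) * C ^ s) \<le> (2 * 10 ^ s) * (card X * card U * card U ^ s)"
    by (rule mult_left_mono) simp
  then have "(2 * (Suc r * card \<B>) * 10 ^ s) * C ^ s \<le> (2 * card X) * card U * (10 * card U) ^ s"
    by (simp only: power_mult_distrib mult_ac)
  also have "\<dots> \<le> 10 ^ s * card U * C ^ s"
    using size(2) small by (intro mult_mono power_mono) (simp_all add: C_def)
  finally have "10 ^ s * (2 * (Suc r * card \<B>)) \<le> 10 ^ s * card U"
    using \<open>C > 0\<close> by (simp add: mult_ac)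
  then show ?thesis
    by simp
qed

lemma ln_ge_3: "3 \<le> ln (x::real)" if "50 \<le> x"
proof -
  have "exp (3::real) = exp 1 ^ 3"
    by (simp flip: exp_of_nat_mult)
  also have "\<dots> \<le> 3 ^ 3"
    by (intro power_mono exp_le) simp
  finally show ?thesis
    using that by (simp add: ln_ge_iff)
qed

text \<open>With \<open>q = n div k\<close>, the logarithmic hypothesis gives \<open>k\<close> at
  most exp((q+1)/50), hence 2n is at most exp(1 + (q+1) + (q+1)/50). For q \<ge> 150 this exponent
  is at most 2(q-3), and exp 2 is at most 9.\<close>

lemma double_le_power_10:
  fixes n k :: nat
  assumes "50 \<le> k" "50 * real k * ln k \<le> n" "150 * k \<le> n"
  shows "2 * n \<le> 10 ^ (n div k - 3)"
proof -
  define q where "q = n div k"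
  have q: "150 \<le> q"
    using assms(1,3) by (simp add: q_def less_eq_div_iff_mult_less_eq)
  have "n < (q + 1) * k"
    unfolding q_def using assms(1) by (metis Suc_eq_plus1 dividend_less_div_times mult.commute
      mult_Suc_right add.commute gr0I not_numeral_le_zero)
  then have n: "real n < (q + 1) * real k"
    by (metis of_nat_less_iff of_nat_mult)
  have "k * (50 * ln k) < k * real (q + 1)"
    using assms(2) n by (simp add: mult_ac)
  then have "ln k < real (q + 1) / 50"
    using assms(1) by simp
  then have k: "real k \<le> exp (real (q + 1) / 50)"
    using assms(1) by (subst ln_le_cancel_iff [symmetric]) auto
  have "2 * real n \<le> 2 * ((q + 1) * real k)"
    using n by simp
  also have "\<dots> \<le> exp 1 * (exp (real (q + 1)) * exp (real (q + 1) / 50))"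
    using k exp_ge_add_one_self [of 1] exp_ge_add_one_self [of "real (q + 1)"]
    by (intro mult_mono) auto
  also have "\<dots> = exp (1 + real (q + 1) + real (q + 1) / 50)"
    by (simp only: exp_add mult.assoc)
  also have "\<dots> \<le> exp (real (q - 3) * 2)"
    using q by (simp add: of_nat_diff field_simps)
  also have "\<dots> = exp 2 ^ (q - 3)"
    by (rule exp_of_nat_mult)
  also have "\<dots> = (exp 1 ^ 2) ^ (q - 3)"
    by (simp add: power2_eq_square mult_exp_exp)
  also have "\<dots> \<le> (3 ^ 2) ^ (q - 3)"
    by (intro power_mono exp_le) simp_all
  also have "\<dots> \<le> 10 ^ (q - 3)"
    by (intro power_mono) simp_all
  finally show ?thesis
    unfolding q_def by (metis (mono_tags) of_nat_le_iff of_nat_mult of_nat_numeral of_nat_power)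
qed

section \<open>Few or many differences of size \<open>k - 1\<close>\<close>

theorem mainTheorem1:
  fixes n k :: nat and F :: "nat set set"
  assumes "k \<ge> 50"
    and "real n \<ge> 50 * real k * ln (real k)"
    and "F \<subseteq> {A. A \<subseteq> {1..n} \<and> card A = k}"
    and "intersecting F"
  shows "card (diff_family F) \<le> (\<Sum>l<k. (n - 1) choose l)"
proof -
  define r where "r = k - 1"
  have k: "k = Suc r"
    using assms(1) by (simp add: r_def)
  let ?X = "{1..n}"
  let ?D = "diff_family F"
  define E where "E = {D \<in> ?D. card D = r}"
  have "150 * real k \<le> 50 * real k * ln k"
    using ln_ge_3 [of k] assms(1) by simp
  then have n150: "150 * k \<le> n"
    using assms(2) by linarith
  have D: "D \<subseteq> ?X" "card D < k" if "D \<in> ?D" for D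
    by (rule diff_familyE [OF that assms(3,4)]; auto)+
  then have E: "E \<subseteq> ksubsets ?X r"
    by (auto simp: E_def)
  have "(n - r) * (n choose r) = n * ((n - 1) choose r)"
    by (rule binomial_absorb_comp)
  then have absorb: "(real n - r) * (n choose r) = n * real ((n - 1) choose r)"
    using n150 k by (simp flip: of_nat_mult of_nat_diff)
  show ?thesis
  proof (cases "real (card E) \<le> (1 - 1 / 50) * (n choose r)")
    \<comment> \<open>Here 49/50 of the level \<open>r\<close> plus 1/100 for all lower levels
      leaves 99/100 of \<open>n choose r\<close>, which is already at most the top term
      \<open>(n - 1) choose r\<close>.\<close>
    case True
    have "?D \<subseteq> E \<union> (\<Union>l<r. ksubsets ?X l)"
    proof
      fix A assume "A \<in> ?D"
      then show "A \<in> E \<union> (\<Union>l<r. ksubsets ?X l)"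
        using D [of A] k by (auto simp: E_def less_Suc_eq)
    qed
    then have "card ?D \<le> card (E \<union> (\<Union>l<r. ksubsets ?X l))"
      using finite_subset [OF E] by (intro card_mono) auto
    also have "\<dots> \<le> card E + card (\<Union>l<r. ksubsets ?X l)"
      by (rule card_Un_le)
    also have "card (\<Union>l<r. ksubsets ?X l) \<le> (\<Sum>l<r. n choose l)"
      using card_UN_le [of "{..<r}" "ksubsets ?X"] by (simp add: n_subsets)
    finally have "card ?D \<le> card E + (\<Sum>l<r. n choose l)"
      by simp
    moreover have "100 * (\<Sum>l<r. n choose l) \<le> n choose r"
      using n150 k by (intro sum_choose_le) simp
    ultimately have "100 * card ?D \<le> 100 * card E + (n choose r)"
      by linarith
    then have "real (100 * card ?D) \<le> real (100 * card E + (n choose r))"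
      by (simp only: of_nat_le_iff)
    then have "100 * real (card ?D) \<le> 99 * real (n choose r)"
      using True by simp
    also have "\<dots> \<le> 100 * real ((n - 1) choose r)"
    proof -
      have "n * (99 * real (n choose r)) \<le> 100 * (real n - r) * real (n choose r)"
        using n150 k by (simp flip: mult.assoc)
      also have "\<dots> = n * (100 * real ((n - 1) choose r))"
        using absorb by (simp only: mult.assoc mult.left_commute [of _ 100])
      finally show ?thesis
        using n150 assms(1) by simp
    qed
    finally have "card ?D \<le> (n - 1) choose r"
      by simp
    then show ?thesis
      by (simp add: k)
  next
    case False
    have "\<exists>y. y \<notin> D \<and> insert y D \<in> F" if "D \<in> E" for D
    proof -
      have "D \<in> ?D"
        using that by (simp add: E_def)
      then obtain A B where AB: "A \<in> F" "D = A - B" "card D + card (A \<inter> B) = k"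
        using assms(3,4) by (elim diff_familyE) auto
      then have "card (A \<inter> B) = 1"
        using that k by (simp add: E_def)
      then obtain y where "A \<inter> B = {y}"
        by (rule card_1_singletonE)
      then have "y \<notin> D" "insert y D = A"
        using AB(2) by auto
      then show ?thesis
        using AB(1) by blast
    qed
    then obtain y where y: "\<And>D. D \<in> E \<Longrightarrow> y D \<notin> D \<and> insert (y D) D \<in> F"
      by metis
    \<comment> \<open>The 1/50 is the density lost in this case; 1/100 is admissible since
      \<open>n\<close> exceeds \<open>101 * r\<close>. The result is 9/10.\<close>
    have "\<exists>z. (1 - 3 * (1 / 50) - 4 * (1 / 100)) * real (card ?X choose r) \<le> card {D \<in> E. y D = z}"
    proof (rule exists_dominant_label [OF _ E])
      show "y D = y D' \<or> y D \<in> D' \<or> y D' \<in> D" if "D \<in> E" "D' \<in> E" "D \<inter> D' = {}" for D D'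
      proof -
        have "insert (y D) D \<in> F" "insert (y D') D' \<in> F"
          using y that(1,2) by auto
        then have "insert (y D) D \<inter> insert (y D') D' \<noteq> {}"
          using assms(4) unfolding intersecting_def by metis
        then show ?thesis
          using that(3) by blast
      qed
    qed (use False n150 k assms(1) in auto)
    then obtain x where x: "9 / 10 * real (n choose r) \<le> card {D \<in> E. y D = x}"
      by auto
    have "n choose r > 0"
      using n150 k by simp
    have "{D \<in> E. y D = x} \<noteq> {}"
    proof
      assume "{D \<in> E. y D = x} = {}"
      with x have "9 / 10 * real (n choose r) \<le> 0"
        by (simp only: card.empty of_nat_0)
      with \<open>n choose r > 0\<close> show False
        by simp
    qed
    then have "x \<in> ?X"
      using y assms(3) by blast
    define Y where "Y = ?X - {x}"
    define \<B> where "\<B> = {A \<in> F. x \<notin> A}"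
    let ?U = "avoiding Y \<B>"
    have Y: "finite Y" "card Y = n - 1"
      using \<open>x \<in> ?X\<close> by (simp_all add: Y_def)
    have \<B>: "\<B> \<subseteq> ksubsets Y (Suc r)"
      using assms(3) k by (auto simp: \<B>_def Y_def)
    have "card {D \<in> E. y D = x} + card (?U r) = card ({D \<in> E. y D = x} \<union> ?U r)"
    proof (rule card_Un_disjoint [symmetric])
      show "finite {D \<in> E. y D = x}"
        using finite_subset [OF E] by simp
      show "{D \<in> E. y D = x} \<inter> ?U r = {}"
      proof (rule ccontr)
        assume "\<not> ?thesis"
        then obtain D B where "D \<in> E" "y D = x" "B \<in> F" "x \<notin> B" "D \<inter> B = {}"
          by (auto simp: avoiding_def \<B>_def)
        then have "insert x D \<in> F" "insert x D \<inter> B = {}"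
          using y by auto
        then show False
          using assms(4) \<open>B \<in> F\<close> unfolding intersecting_def by metis
      qed
    qed (simp add: finite_avoiding Y)
    also have "\<dots> \<le> card (ksubsets Y r)"
      using E y Y(1) by (intro card_mono) (auto simp: avoiding_def Y_def)
    finally have "card {D \<in> E. y D = x} + card (?U r) \<le> (n - 1) choose r"
      using Y by (simp add: n_subsets)
    then have "real (card {D \<in> E. y D = x}) + real (card (?U r)) \<le> real ((n - 1) choose r)"
      by (simp only: of_nat_le_iff flip: of_nat_add)
    moreover have "(n - 1) choose r \<le> n choose r"
      by (rule binomial_right_mono) simp
    then have "real ((n - 1) choose r) \<le> real (n choose r)"
      by (simp only: of_nat_le_iff)
    ultimately have "10 * real (card (?U r)) \<le> real ((n - 1) choose r)"
      using x by linarith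
    then have "real (10 * card (?U r)) \<le> real ((n - 1) choose r)"
      by simp
    then have U: "10 * card (?U r) \<le> card Y choose r"
      using Y by (simp only: of_nat_le_iff)
    \<comment> \<open>Of the \<open>n div k\<close> blocks of size \<open>k\<close>,
      \<open>s + 1\<close> hold the random sets, one holds \<open>B\<close>, and one is spare to pay
      for the deleted point \<open>x\<close>.\<close>
    define s where "s = n div k - 3"
    have div: "150 \<le> n div k" "n div k * k \<le> n"
      using assms(1) n150 by (simp_all add: less_eq_div_iff_mult_less_eq)
    have "Suc s * r + Suc r \<le> Suc s * k + k"
      using k by (intro add_mono mult_left_mono) auto
    also have "\<dots> \<le> n - 1"
    proof -
      have "n div k = s + 3"
        using div(1) by (simp add: s_def)
      then have "Suc s * k + k + k = n div k * k"
        by (simp add: algebra_simps)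
      then show ?thesis
        using div(2) k by linarith
    qed
    finally have "Suc s * r + Suc r \<le> card Y"
      using Y by simp
    moreover have "2 * card Y \<le> 10 ^ s"
      using double_le_power_10 [OF assms(1,2) n150] Y by (simp add: s_def)
    ultimately have "2 * (Suc r * card \<B>) \<le> card (?U r)"
      using Y(1) \<B> U by (intro mult_card_avoided_family_le) (auto simp: avoiding_def)
    moreover have "100 * (\<Sum>l<r. card (?U l)) \<le> card (?U r)"
      using Y n150 k by (intro sum_card_avoiding_le [OF _ \<B>]) auto
    moreover have "card ?D + card (?U r) \<le> (\<Sum>l<k. (n - 1) choose l) + (\<Sum>l<r. card (?U l)) + k * card \<B>"
      using card_diff_family_le [OF _ assms(3,4) \<open>x \<in> ?X\<close>] by (simp add: Y_def \<B>_def r_def)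
    \<comment> \<open>The gain is at most 1/100 and the shadow at most 1/2 of
      \<open>card (?U r)\<close>, less than the loss.\<close>
    ultimately show ?thesis
      unfolding k by linarith
  qed
qed

end
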